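(* Define real matrices $P_k \in \mathbb{R}^{k \times (k+1)}$, $k \geq 1$, recursively by $$P_1 = \begin{pmatrix} 1 & -1 \end{pmatrix} \in \mathbb{R}^{1 \times 2}, \qquad P_k = \begin{pmatrix} 1 & -\frac{1}{k}\mathbf{1}^T \\ \mathbf{0} & \sqrt{1-\frac{1}{k^2}}\, P_{k-1} \end{pmatrix} \in \mathbb{R}^{k \times (k+1)} \quad (k \geq 2),$$ where $\mathbf{1} \in \mathbb{R}^{k}$ is the all-ones column vector and $\mathbf{0} \in \mathbb{R}^{k-1}$ is the zero column vector. Then for every integer $k \geq 1$, $P_k$ is a maximally separated matrix.
   Context: Let $\mathbb{S}^{k-1} = \{x \in \mathbb{R}^k : \|x\| = 1\}$ be the Euclidean unit sphere, and let $\langle \cdot,\cdot\rangle$ denote cosine similarity, $\langle x, y\rangle = \frac{x^T y}{\|x\|\|y\|}$ (which equals the standard inner product for unit vectors). Definition (maximally separated matrix). Let $k \geq 1$. A matrix $P = [p_0, \ldots, p_k] \in \mathbb{R}^{k \times (k+1)}$ with $k+1$ column vectors $p_0,\ldots,p_k$ is called maximally separated if: (i) $p_i \in \mathbb{S}^{k-1}$ for all $i \in \{0,\ldots,k\}$; (ii) $\langle p_i, p_j \rangle = \langle p_i, p_l \rangle$ for all $i,j,l \in \{0,\ldots,k\}$ with $i \neq j$ and $i \neq l$; (iii) $\sum_{i=0}^{k} p_i = 0$. *)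

theory Defs
  imports Complex_Main "Jordan_Normal_Form.Matrix"
begin

definition enorm :: "real vec \<Rightarrow> real" where
  "enorm x = sqrt (x \<bullet> x)"

(* The argument is the ambient dimension: unit_sphere k is the (k-1)-dimensional sphere in R^k. *)
definition unit_sphere :: "nat \<Rightarrow> real vec set" where
  "unit_sphere k = {x \<in> carrier_vec k. enorm x = 1}"

definition cosine_similarity :: "real vec \<Rightarrow> real vec \<Rightarrow> real" where
  "cosine_similarity x y = (x \<bullet> y) / (enorm x * enorm y)"

definition maximally_separated :: "nat \<Rightarrow> real mat \<Rightarrow> bool" where
  "maximally_separated k P \<longleftrightarrow>
     k \<ge> 1 \<and> P \<in> carrier_mat k (k + 1) \<and>
     (\<forall>i \<in> {0..k}. col P i \<in> unit_sphere k) \<and>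
     (\<forall>i \<in> {0..k}. \<forall>j \<in> {0..k}. \<forall>l \<in> {0..k}. i \<noteq> j \<longrightarrow> i \<noteq> l \<longrightarrow>
        cosine_similarity (col P i) (col P j) = cosine_similarity (col P i) (col P l)) \<and>
     finsum_vec TYPE(real) k (col P) {0..k} = 0\<^sub>v k"

(* The recursion starts at index 1; the value at index 0 is a dummy that the later cases never use. *)
fun sep_mat :: "nat \<Rightarrow> real mat" where
  "sep_mat 0 = 0\<^sub>m 0 1"
| "sep_mat (Suc 0) = mat_of_rows_list 2 [[1, -1]]"
| "sep_mat (Suc (Suc n)) =
     (let k = Suc (Suc n) in
      four_block_mat
        (1\<^sub>m 1)        (- (1 / real k) \<cdot>\<^sub>m mat 1 k (\<lambda>_. 1))
        (0\<^sub>m (k - 1) 1) (sqrt (1 - 1 / (real k)\<^sup>2) \<cdot>\<^sub>m sep_mat (k - 1)))"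

end

(* Up to its first coordinate, each later column of P_k is a scaled column of P_(k-1).
   Induction on k therefore shows that the Gram matrix has diagonal entries 1 and off-diagonal
   entries -1/k, the inductive step being 1/k^2 - (1 - 1/k^2)/(k-1) = -1/k, and that all rows
   sum to zero. *)
theory Submission
  imports Defs
begin

lemma sep_mat_carrier: "sep_mat n \<in> carrier_mat n (Suc n)"
proof (induction n rule: sep_mat.induct)
  case 2
  show ?case by (intro carrier_matI) (simp_all add: mat_of_rows_list_def)
next
  case (3 n)
  then show ?case by (auto simp: Let_def)
qed simp

lemma dim_sep_mat [simp]: "dim_row (sep_mat n) = n" "dim_col (sep_mat n) = Suc n"
  using sep_mat_carrier[of n] by auto

text \<open>One entry formula serves both nonzero cases of the recursion: at \<open>n = 0\<close>
  the entry \<open>- 1 / real (Suc n)\<close> is the -1 of P_1, and the scaled branch is never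
  reached because the only row is 0.\<close>

lemma sep_mat_Suc_index:
  assumes "i < Suc n" "j < Suc (Suc n)"
  shows "sep_mat (Suc n) $$ (i, j) =
    (if i = 0 then if j = 0 then 1 else - 1 / real (Suc n)
     else if j = 0 then 0 else sqrt (1 - 1 / (real (Suc n))\<^sup>2) * sep_mat n $$ (i - 1, j - 1))"
proof (cases n)
  case 0
  then show ?thesis
    using assms by (auto simp: mat_of_rows_list_def less_Suc_eq)
next
  case (Suc m)
  then show ?thesis
    using assms by (auto simp: Let_def)
qed

declare sep_mat.simps [simp del]

text \<open>The index starts at \<open>Suc n\<close> because the diagonal claim fails for
  \<open>sep_mat 0\<close>, whose single column is empty and has product 0 with itself.\<close>

lemma col_sep_mat_scalar_prod:
  assumes "i < Suc (Suc n)" "j < Suc (Suc n)"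
  shows "col (sep_mat (Suc n)) i \<bullet> col (sep_mat (Suc n)) j = (if i = j then 1 else - 1 / real (Suc n))"
  using assms
proof (induction n arbitrary: i j)
  case 0
  then have "i \<in> {0, 1}" "j \<in> {0, 1}"
    by auto
  then show ?case
    by (auto simp: scalar_prod_def sep_mat_Suc_index)
next
  case (Suc n)
  let ?k = "real (Suc (Suc n))"
  \<comment> \<open>The radicand has to be nonnegative for squaring to undo the root.\<close>
  have "1 \<le> ?k\<^sup>2"
    by (intro one_le_power) simp
  then have "0 \<le> 1 - 1 / ?k\<^sup>2"
    by (simp add: divide_le_eq_1 del: of_nat_Suc)
  then have k2: "(sqrt (1 - 1 / ?k\<^sup>2))\<^sup>2 = 1 - 1 / ?k\<^sup>2"
    by (rule real_sqrt_pow2)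
  \<comment> \<open>Row 0 is split off; the remaining rows carry the scaled copy of the previous
    matrix.\<close>
  have split: "col (sep_mat (Suc (Suc n))) i \<bullet> col (sep_mat (Suc (Suc n))) j =
      sep_mat (Suc (Suc n)) $$ (0, i) * sep_mat (Suc (Suc n)) $$ (0, j) +
      (\<Sum>r = 0..<Suc n. sep_mat (Suc (Suc n)) $$ (Suc r, i) * sep_mat (Suc (Suc n)) $$ (Suc r, j))"
    using Suc.prems
    by (simp add: scalar_prod_def sum.atLeast0_lessThan_Suc_shift del: sum.op_ivl_Suc)
  show ?case
  proof (cases "i = 0 \<or> j = 0")
    \<comment> \<open>Column 0 is the first unit vector, so the product is the top entry of the
      other column.\<close>
    case True
    then show ?thesis
      using Suc.prems unfolding split
      by (auto simp: sep_mat_Suc_index simp del: sum.op_ivl_Suc)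
  next
    case False
    then have ij: "i - 1 < Suc (Suc n)" "j - 1 < Suc (Suc n)" "i - 1 = j - 1 \<longleftrightarrow> i = j"
      using Suc.prems by auto
    have "(\<Sum>r = 0..<Suc n. sep_mat (Suc (Suc n)) $$ (Suc r, i) * sep_mat (Suc (Suc n)) $$ (Suc r, j)) =
        (\<Sum>r = 0..<Suc n. (sqrt (1 - 1 / ?k\<^sup>2))\<^sup>2 *
          (sep_mat (Suc n) $$ (r, i - 1) * sep_mat (Suc n) $$ (r, j - 1)))"
      using Suc.prems False
      by (intro sum.cong refl)
        (simp add: sep_mat_Suc_index[of _ "Suc n"] power2_eq_square del: sum.op_ivl_Suc)
    also have "\<dots> = (1 - 1 / ?k\<^sup>2) * (col (sep_mat (Suc n)) (i - 1) \<bullet> col (sep_mat (Suc n)) (j - 1))"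
      using ij unfolding k2
      by (simp add: scalar_prod_def sum_distrib_left del: sum.op_ivl_Suc)
    also have "\<dots> = (1 - 1 / ?k\<^sup>2) * (if i = j then 1 else - 1 / real (Suc n))"
      using Suc.IH[OF ij(1,2)] ij(3) by simp
    finally have "col (sep_mat (Suc (Suc n))) i \<bullet> col (sep_mat (Suc (Suc n))) j =
        1 / ?k\<^sup>2 + (1 - 1 / ?k\<^sup>2) * (if i = j then 1 else - 1 / real (Suc n))"
      using False Suc.prems unfolding split
      by (simp add: sep_mat_Suc_index[of 0] power2_eq_square del: sum.op_ivl_Suc)
    \<comment> \<open>Off the diagonal, with k = n + 2, (1 - 1/k^2)/(k - 1) = (k + 1)/k^2, which
      leaves -k/k^2. On the diagonal the terms 1/k^2 cancel.\<close>
    moreover have "1 / ?k\<^sup>2 - (1 - 1 / ?k\<^sup>2) / real (Suc n) = - 1 / ?k"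
      by (simp add: power2_eq_square divide_simps) (simp add: algebra_simps)
    ultimately show ?thesis
      by simp
  qed
qed

lemma sum_row_sep_mat:
  assumes "i < n"
  shows "(\<Sum>j = 0..n. sep_mat n $$ (i, j)) = 0"
  using assms
proof (induction n arbitrary: i)
  case (Suc n)
  have "(\<Sum>j = 0..Suc n. sep_mat (Suc n) $$ (i, j)) =
      sep_mat (Suc n) $$ (i, 0) + (\<Sum>j = 0..n. sep_mat (Suc n) $$ (i, Suc j))"
    by (simp add: sum.atLeast0_atMost_Suc_shift del: sum.cl_ivl_Suc)
  also have "\<dots> = 0"
  proof (cases i)
    \<comment> \<open>The leading 1 cancels against \<open>Suc n\<close> entries equal to
      \<open>- 1 / real (Suc n)\<close>.\<close>
    case 0
    then show ?thesis
      by (simp add: sep_mat_Suc_index)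
  next
    \<comment> \<open>A lower row is 0 followed by a multiple of row \<open>r\<close> of the
      previous matrix.\<close>
    case (Suc r)
    then show ?thesis
      using Suc.prems Suc.IH[of r]
      by (simp add: sep_mat_Suc_index sum_distrib_left[symmetric])
  qed
  finally show ?case .
qed simp

theorem theorem1:
  fixes k :: nat
  assumes "k \<ge> 1"
  shows "maximally_separated k (sep_mat k)"
proof -
  have gram: "col (sep_mat k) i \<bullet> col (sep_mat k) j = (if i = j then 1 else - 1 / real k)"
    if "i \<le> k" "j \<le> k" for i j
    using that assms col_sep_mat_scalar_prod[of i "k - 1" j] by simp
  \<comment> \<open>Unit norms turn cosine similarity into the inner product, so the common value
    \<open>- 1 / real k\<close> from \<open>gram\<close> gives equal similarities.\<close>
  have norm: "enorm (col (sep_mat k) i) = 1" if "i \<le> k" for i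
    using gram[OF that that] by (simp add: enorm_def)
  have cols: "col (sep_mat k) \<in> {0..k} \<rightarrow> carrier_vec k"
    by (auto intro: carrier_vecI)
  \<comment> \<open>Coordinate \<open>i\<close> of the sum of the columns is the sum of row
    \<open>i\<close>.\<close>
  have "finsum_vec TYPE(real) k (col (sep_mat k)) {0..k} = 0\<^sub>v k"
  proof (rule eq_vecI)
    fix i assume "i < dim_vec (0\<^sub>v k :: real vec)"
    then have i: "i < k" by simp
    have "finsum_vec TYPE(real) k (col (sep_mat k)) {0..k} $ i =
        (\<Sum>j = 0..k. col (sep_mat k) j $ i)"
      using i cols by (intro index_finsum_vec) auto
    also have "\<dots> = 0"
      using i sum_row_sep_mat[OF i] by simp
    finally show "finsum_vec TYPE(real) k (col (sep_mat k)) {0..k} $ i = 0\<^sub>v k $ i"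
      using i by simp
  next
    show "dim_vec (finsum_vec TYPE(real) k (col (sep_mat k)) {0..k}) = dim_vec (0\<^sub>v k :: real vec)"
      using finsum_vec_closed[OF cols] by auto
  qed
  then show ?thesis
    using assms sep_mat_carrier[of k] gram norm
    by (auto simp: maximally_separated_def unit_sphere_def cosine_similarity_def intro: carrier_vecI)
qed

end
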